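(* Let $n\in\mathbb{N}_0$ and let $f=\sum_{l=0}^n\sum_{k=-l}^l\hat f_l^k\,Y_l^k$ with $\hat f_l^k\in\mathbb{C}$ be a spherical harmonic polynomial of degree at most $n$ on $\mathbb{S}^2$. Let $p,q\in\mathbb{N}$ with $2p$ and $q$ coprime and $p>n$, and let $\gamma=\gamma_2\circ\gamma_1:[0,1]\to\mathbb{S}^2$ be the (piecewise smooth, possibly discontinuous) curve given by $$\gamma_1(t)=(\theta(t),\varphi(t))=\left(2\pi pt\bmod\pi,\ 2\pi qt\bmod 2\pi\right),\qquad \gamma_2(\theta,\varphi)=(\sin\theta\cos\varphi,\sin\theta\sin\varphi,\cos\theta).$$ Then $$\frac{1}{4\pi}\int_{\mathbb{S}^2}f(x)\,\mathrm{d}\omega(x)=\frac{1}{C_\gamma}\int_\gamma f(x)\,\mathrm{d}\tilde\sigma(x),$$ where $\mathrm{d}\tilde\sigma(x)=\tilde w(\arccos x_3)\,\mathrm{d}\sigma(x)$ for $x=(x_1,x_2,x_3)\in\mathbb{S}^2$, with $$\tilde w(\theta)=\sqrt{\frac{(p^2+q^2)\sin^2\theta}{p^2+q^2\sin^2\theta}},$$ and $C_\gamma=\int_\gamma\mathrm{d}\tilde\sigma(x)=4\sqrt{p^2+q^2}$.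
   Context: $\mathbb{N}=\{1,2,\dots\}$, $\mathbb{N}_0=\mathbb{N}\cup\{0\}$, $\mathbb{S}^2=\{x\in\mathbb{R}^3:\|x\|_2=1\}$. The surface measure is $\int_{\mathbb{S}^2}f\,\mathrm{d}\omega=\int_0^{2\pi}\int_0^\pi f(\theta,\varphi)\sin\theta\,\mathrm{d}\theta\,\mathrm{d}\varphi$, where $f(\theta,\varphi)$ means $f(\gamma_2(\theta,\varphi))$. The spherical harmonics in colatitude-longitude coordinates are $Y_l^k(\theta,\varphi)=\mathrm{e}^{ik\varphi}P_l^k(\cos\theta)$, $l\in\mathbb{N}_0$, $k=-l,\dots,l$, with $P_l^k$ the associated Legendre functions. $\mathrm{d}\sigma$ is arc length along the curve, so $\int_\gamma g(x)\,\mathrm{d}\sigma(x)=\int_0^1 g(\gamma(t))\|\dot\gamma(t)\|_2\,\mathrm{d}t$, where the derivative is taken on the smooth pieces; the curve consists of $2p$ segments from the north pole to the south pole, and the jumps between poles caused by "mod $\pi$" contribute nothing. Here $\|\dot\gamma(t)\|_2=2\pi\sqrt{p^2+q^2\sin^2(2\pi pt)}$. *)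

theory Defs
  imports "HOL-Analysis.Analysis" "HOL-Library.Real_Mod"
begin

definition sph_point :: "real \<Rightarrow> real \<Rightarrow> real ^ 3" where
  "sph_point \<theta> \<phi> = vector [sin \<theta> * cos \<phi>, sin \<theta> * sin \<phi>, cos \<theta>]"

(* Rodrigues' formula
     P_l^m(x) = (-1)^m / (2^l l!) (1 - x^2)^(m/2) (d/dx)^(l+m) (x^2 - 1)^l   for m >= 0,
   extended to negative orders by P_l^(-m) = (-1)^m (l-m)!/(l+m)! P_l^m. *)
definition assoc_legendre :: "nat \<Rightarrow> int \<Rightarrow> real \<Rightarrow> real" where
  "assoc_legendre l k x =
     (let m = nat \<bar>k\<bar>;
          P = (-1) ^ m / (2 ^ l * fact l) * sqrt (1 - x\<^sup>2) ^ m
                * poly ((pderiv ^^ (l + m)) ([:-1, 0, 1:] ^ l)) x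
      in if k \<ge> 0 then P else (-1) ^ m * (fact (l - m) / fact (l + m)) * P)"

definition sph_harm_coord :: "nat \<Rightarrow> int \<Rightarrow> real \<Rightarrow> real \<Rightarrow> complex" where
  "sph_harm_coord l k \<theta> \<phi> =
     exp (\<i> * of_int k * of_real \<phi>) * of_real (assoc_legendre l k (cos \<theta>))"

(* The function on the unit sphere (the values elsewhere are irrelevant), read off at the
   colatitude arccos x_3 and the longitude arg (x_1 + i x_2) in [0, 2 pi), which is 0 at
   the poles.  By sph_harm_sph_point the choice of longitude is immaterial. *)
definition sph_harm :: "nat \<Rightarrow> int \<Rightarrow> real ^ 3 \<Rightarrow> complex" where
  "sph_harm l k x = sph_harm_coord l k (arccos (x $ 3)) (Arg2pi (Complex (x $ 1) (x $ 2)))"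

lemma sph_harm_sph_point:
  assumes "0 \<le> \<theta>" "\<theta> \<le> pi"
  shows "sph_harm l k (sph_point \<theta> \<phi>) = sph_harm_coord l k \<theta> \<phi>"
proof (cases "sin \<theta> = 0")
  case True
  then have "(cos \<theta>)\<^sup>2 = 1"
    using sin_cos_squared_add[of \<theta>] by simp
  then have "assoc_legendre l k (cos \<theta>) = 0" if "k \<noteq> 0"
    using that by (simp add: assoc_legendre_def Let_def)
  then show ?thesis
    using assms by (cases "k = 0") (auto simp: sph_harm_def sph_harm_coord_def sph_point_def arccos_cos)
next
  case False
  then have pos: "sin \<theta> > 0"
    using sin_ge_zero[OF assms] by linarith
  define z where "z = Complex (sin \<theta> * cos \<phi>) (sin \<theta> * sin \<phi>)"
  have z: "z = of_real (sin \<theta>) * cis \<phi>"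
    by (simp add: z_def complex_eq_iff)
  then have "cmod z = sin \<theta>"
    using pos by (simp add: norm_mult)
  then have "cis (Arg2pi z) = cis \<phi>"
    using z Arg2pi_eq[of z] pos by (simp add: cis_conv_exp)
  then have "cis (Arg2pi z) powi k = cis \<phi> powi k"
    by simp
  then have "exp (\<i> * of_int k * of_real (Arg2pi z)) = exp (\<i> * of_int k * of_real \<phi>)"
    by (simp add: cis_conv_exp exp_power_int mult_ac)
  then show ?thesis
    using assms by (simp add: sph_harm_def sph_harm_coord_def sph_point_def z_def arccos_cos)
qed

definition sphere_integral :: "(real ^ 3 \<Rightarrow> complex) \<Rightarrow> complex" where
  "sphere_integral f =
     integral {0..2 * pi} (\<lambda>\<phi>. integral {0..pi} (\<lambda>\<theta>. sin \<theta> *\<^sub>R f (sph_point \<theta> \<phi>)))"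

definition sph_curve :: "nat \<Rightarrow> nat \<Rightarrow> real \<Rightarrow> real ^ 3" where
  "sph_curve p q t =
     sph_point ((2 * pi * real p * t) rmod pi) ((2 * pi * real q * t) rmod (2 * pi))"

(* Integration with respect to arc length.  For a piecewise smooth curve, possibly with jumps,
   the derivative exists off a finite set; on that null set the value of the
   integrand is irrelevant, so the jumps contribute nothing. *)
definition arc_integral ::
    "(real \<Rightarrow> real ^ 3) \<Rightarrow> (real ^ 3 \<Rightarrow> 'b::real_normed_vector) \<Rightarrow> 'b" where
  "arc_integral \<gamma> g =
     integral {0..1} (\<lambda>t. norm (vector_derivative \<gamma> (at t)) *\<^sub>R g (\<gamma> t))"

definition curve_weight :: "nat \<Rightarrow> nat \<Rightarrow> real \<Rightarrow> real" where
  "curve_weight p q \<theta> =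
     sqrt (((real p)\<^sup>2 + (real q)\<^sup>2) * (sin \<theta>)\<^sup>2 / ((real p)\<^sup>2 + (real q)\<^sup>2 * (sin \<theta>)\<^sup>2))"

definition weighted_curve_integral ::
    "nat \<Rightarrow> nat \<Rightarrow> (real ^ 3 \<Rightarrow> 'b::real_normed_vector) \<Rightarrow> 'b" where
  "weighted_curve_integral p q g =
     arc_integral (sph_curve p q) (\<lambda>x. curve_weight p q (arccos (x $ 3)) *\<^sub>R g x)"

definition curve_mass :: "nat \<Rightarrow> nat \<Rightarrow> real" where
  "curve_mass p q = weighted_curve_integral p q (\<lambda>x. 1)"

end

theory Submission
  imports Defs
begin

text \<open>The weight turns arc length into \<open>2 \<pi> sqrt (p\<^sup>2 + q\<^sup>2) sin \<theta> dt\<close>, so that on the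
  \<open>j\<close>-th of the \<open>2p\<close> segments the curve integral is, up to a constant, the integral of
  \<open>sin \<theta> f(\<theta>, q (\<theta> + j \<pi>) / p)\<close> over \<open>0 \<le> \<theta> \<le> \<pi>\<close>.  At a fixed colatitude the \<open>2p\<close> longitudes
  are equally spaced, since \<open>2p\<close> and \<open>q\<close> are coprime; averaging over them therefore annihilates
  every frequency \<open>0 < |k| < 2p\<close>, just as integration over all longitudes does.  Both sides
  reduce to the same integral of the zonal part of \<open>f\<close>, and no property of the
  Legendre functions beyond continuity is needed.\<close>

section \<open>Spherical coordinates and the speed of a smooth segment\<close>

lemma sph_point_rmod_2pi [simp]: "sph_point \<theta> (\<phi> rmod (2 * pi)) = sph_point \<theta> \<phi>"
  by (simp add: sph_point_def)

lemma norm_vector_3_squared: "(norm (vector [x, y, z] :: real ^ 3))\<^sup>2 = x\<^sup>2 + y\<^sup>2 + z\<^sup>2"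
  by (simp add: norm_eq_sqrt_inner inner_vec_def sum_3 power2_eq_square)

lemma sph_point_in_sphere: "sph_point \<theta> \<phi> \<in> sphere 0 1"
proof -
  have "(norm (sph_point \<theta> \<phi>))\<^sup>2
      = (sin \<theta>)\<^sup>2 * ((cos \<phi>)\<^sup>2 + (sin \<phi>)\<^sup>2) + (cos \<theta>)\<^sup>2"
    by (simp only: sph_point_def norm_vector_3_squared power_mult_distrib distrib_left)
  then have "(norm (sph_point \<theta> \<phi>))\<^sup>2 = 1"
    by simp
  then show ?thesis
    by (simp add: power2_eq_1_iff) (use norm_ge_zero[of "sph_point \<theta> \<phi>"] in linarith)
qed

text \<open>Affine coordinates model one segment: the offset \<open>b\<close> undoes the reduction
  modulo \<pi> of the colatitude, while the longitude, entering only through \<open>sin\<close> and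
  \<open>cos\<close>, needs no offset.\<close>

lemma has_vector_derivative_sph_point:
  "((\<lambda>t. sph_point (a * t + b) (c * t)) has_vector_derivative
     vector [a * (cos (a * t + b) * cos (c * t)) - c * (sin (a * t + b) * sin (c * t)),
             a * (cos (a * t + b) * sin (c * t)) + c * (sin (a * t + b) * cos (c * t)),
             - a * sin (a * t + b)]) (at t)"
proof -
  \<comment> \<open>In the standard basis the point is a sum of scalar multiples of fixed vectors,
    to which the derivative rules apply.\<close>
  have vec: "vector [x, y, z] = x *\<^sub>R axis 1 1 + y *\<^sub>R axis 2 1 + z *\<^sub>R (axis 3 1 :: real ^ 3)"
    for x y z :: real
    by (simp add: vec_eq_iff forall_3 axis_def)
  show ?thesis
    unfolding sph_point_def vec
    by (rule derivative_eq_intros has_vector_derivative_scaleR refl | simp add: algebra_simps)+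
qed

lemma norm_vector_derivative_sph_point:
  "norm (vector_derivative (\<lambda>t. sph_point (a * t + b) (c * t)) (at t))
     = sqrt (a\<^sup>2 + c\<^sup>2 * (sin (a * t + b))\<^sup>2)"
proof -
  define s where "s = a * t + b"
  define u where "u = c * t"
  have "(norm (vector_derivative (\<lambda>t. sph_point (a * t + b) (c * t)) (at t)))\<^sup>2
      = (a * (cos s * cos u) - c * (sin s * sin u))\<^sup>2 + (a * (cos s * sin u) + c * (sin s * cos u))\<^sup>2
        + (- a * sin s)\<^sup>2"
    by (simp only: vector_derivative_at[OF has_vector_derivative_sph_point] norm_vector_3_squared
          s_def u_def)
  \<comment> \<open>The mixed terms of the first two squares have opposite signs and cancel.\<close>
  also have "\<dots> = a\<^sup>2 * (cos s)\<^sup>2 * ((sin u)\<^sup>2 + (cos u)\<^sup>2) + c\<^sup>2 * (sin s)\<^sup>2 * ((sin u)\<^sup>2 + (cos u)\<^sup>2)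
      + a\<^sup>2 * (sin s)\<^sup>2"
    by algebra
  also have "\<dots> = a\<^sup>2 * ((sin s)\<^sup>2 + (cos s)\<^sup>2) + c\<^sup>2 * (sin s)\<^sup>2"
    unfolding sin_cos_squared_add[of u] by (simp only: algebra_simps mult_1_right)
  also have "\<dots> = a\<^sup>2 + c\<^sup>2 * (sin s)\<^sup>2"
    by simp
  finally show ?thesis
    unfolding s_def by (metis norm_ge_zero real_sqrt_unique)
qed

section \<open>Splitting the weighted curve integral into segments\<close>

lemma has_integral_unit_interval_pieces:
  fixes G :: "real \<Rightarrow> 'a::banach"
  assumes "N > 0"
    and "\<And>j. j < N \<Longrightarrow> (G has_integral I j) {real j / real N..real (Suc j) / real N}"
  shows "(G has_integral (\<Sum>j<N. I j)) {0..1}"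
proof -
  have "m \<le> N \<Longrightarrow> (G has_integral (\<Sum>j<m. I j)) {0..real m / real N}" for m
  proof (induction m)
    case (Suc m)
    then have "(G has_integral (\<Sum>j<m. I j)) {0..real m / real N}"
      and "(G has_integral I m) {real m / real N..real (Suc m) / real N}"
      using assms(2) by auto
    then show ?case
      by (simp only: sum.lessThan_Suc)
         (rule has_integral_combine[rotated 2], auto simp: divide_right_mono)
  qed (simp add: has_integral_refl)
  from this[of N] assms(1) show ?thesis
    by simp
qed

text \<open>The strict bounds keep \<open>t\<close> away from the jumps of the colatitude between
  \<pi> and 0; the longitude is unwrapped by periodicity.\<close>

lemma sph_curve_segment:
  assumes "real j * pi < 2 * pi * real p * t" "2 * pi * real p * t < real (Suc j) * pi"
  shows "sph_curve p q t = sph_point (2 * pi * real p * t - real j * pi) (2 * pi * real q * t)"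
proof -
  have "(2 * pi * real p * t) rmod pi = 2 * pi * real p * t - real j * pi"
    by (rule rmod_unique[where n = "int j"]) (use assms in \<open>auto simp: algebra_simps\<close>)
  then show ?thesis
    by (simp add: sph_curve_def)
qed

text \<open>The root in the speed is, up to the factor \<open>2 * pi\<close>, the denominator of the
  weight, so the two cancel.\<close>

lemma weighted_speed_segment:
  assumes p: "p > 0"
    and t: "real j * pi < 2 * pi * real p * t" "2 * pi * real p * t < real (Suc j) * pi"
  defines "s \<equiv> 2 * pi * real p * t - real j * pi"
  shows "norm (vector_derivative (sph_curve p q) (at t)) * curve_weight p q (arccos (sph_curve p q t $ 3))
    = 2 * pi * sqrt ((real p)\<^sup>2 + (real q)\<^sup>2) * sin s"
proof -
  \<comment> \<open>On this open neighbourhood of \<open>t\<close> the curve coincides with the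
    smooth curve \<open>?g\<close>, so both have the same derivative at \<open>t\<close>.\<close>
  let ?U = "{t. real j * pi < 2 * pi * real p * t} \<inter> {t. 2 * pi * real p * t < real (Suc j) * pi}"
  let ?g = "\<lambda>t. sph_point (2 * pi * real p * t + - (real j * pi)) (2 * pi * real q * t)"
  have "(?g has_vector_derivative vector_derivative ?g (at t)) (at t)"
    by (simp only: vector_derivative_at[OF has_vector_derivative_sph_point] has_vector_derivative_sph_point)
  moreover have "open ?U"
    by (intro open_Int open_Collect_less continuous_intros)
  moreover have "t \<in> ?U"
    using t by simp
  moreover have "?g t' = sph_curve p q t'" if "t' \<in> ?U" for t'
    using that sph_curve_segment[of j p t' q] by simp
  ultimately have "(sph_curve p q has_vector_derivative vector_derivative ?g (at t)) (at t)"
    by (rule has_vector_derivative_transform_within_open)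
  then have "norm (vector_derivative (sph_curve p q) (at t))
      = sqrt ((2 * pi * real p)\<^sup>2 + (2 * pi * real q)\<^sup>2 * (sin s)\<^sup>2)"
    using norm_vector_derivative_sph_point[of "2 * pi * real p" "- (real j * pi)" "2 * pi * real q" t]
    by (simp add: vector_derivative_at s_def)
  also have "\<dots> = sqrt ((2 * pi)\<^sup>2 * ((real p)\<^sup>2 + (real q)\<^sup>2 * (sin s)\<^sup>2))"
    by (simp add: power_mult_distrib algebra_simps)
  also have "\<dots> = 2 * pi * sqrt ((real p)\<^sup>2 + (real q)\<^sup>2 * (sin s)\<^sup>2)"
    by (simp add: real_sqrt_mult)
  finally have speed: "norm (vector_derivative (sph_curve p q) (at t))
      = 2 * pi * sqrt ((real p)\<^sup>2 + (real q)\<^sup>2 * (sin s)\<^sup>2)" .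
  have s: "0 < s" "s < pi"
    using t by (auto simp: s_def algebra_simps)
  then have "arccos (sph_curve p q t $ 3) = s"
    using sph_curve_segment[OF t] by (simp add: sph_point_def s_def [symmetric] arccos_cos)
  \<comment> \<open>A positive radicand permits the cancellation, and a positive
    \<open>sin s\<close> is the root of its own square.\<close>
  moreover have "(real p)\<^sup>2 + (real q)\<^sup>2 * (sin s)\<^sup>2 > 0"
    using p by (simp add: add_pos_nonneg)
  moreover have "sin s > 0"
    using s by (simp add: sin_gt_zero)
  ultimately show ?thesis
    unfolding speed curve_weight_def
    by (simp add: real_sqrt_mult real_sqrt_divide)
qed

text \<open>The substitution s = 2 \<pi> p t - j \<pi> turns the longitude 2 \<pi> q t into q (s + j
  \<pi>) / p. Its Jacobian 1 / (2 \<pi> p), multiplied by the constant of the weighted speed, gives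
  the factor in front.\<close>

lemma weighted_curve_integral_eq_sum:
  fixes g :: "real ^ 3 \<Rightarrow> 'b::banach"
  assumes p: "p > 0"
    and int: "\<And>j. (\<lambda>s. sin s *\<^sub>R g (sph_point s (real q * (s + real j * pi) / real p)))
                 integrable_on {0..pi}"
  shows "weighted_curve_integral p q g = (sqrt ((real p)\<^sup>2 + (real q)\<^sup>2) / real p) *\<^sub>R
    (\<Sum>j<2 * p. integral {0..pi} (\<lambda>s. sin s *\<^sub>R g (sph_point s (real q * (s + real j * pi) / real p))))"
proof -
  define S where "S = sqrt ((real p)\<^sup>2 + (real q)\<^sup>2)"
  define h where "h j s = sin s *\<^sub>R g (sph_point s (real q * (s + real j * pi) / real p))" for j s
  let ?G = "\<lambda>t. norm (vector_derivative (sph_curve p q) (at t)) *\<^sub>R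
              (curve_weight p q (arccos (sph_curve p q t $ 3)) *\<^sub>R g (sph_curve p q t))"
  have "(?G has_integral (S / real p) *\<^sub>R integral {0..pi} (h j))
      {real j / real (2 * p)..real (Suc j) / real (2 * p)}" for j
  proof -
    have "(h j has_integral integral {0..pi} (h j)) {0..pi}"
      using int by (simp add: h_def [abs_def] integrable_integral)
    moreover have "2 * pi * real p > 0"
      using p by simp
    ultimately have aff: "((\<lambda>t. h j ((2 * pi * real p) *\<^sub>R t + - (real j * pi))) has_integral
        integral {0..pi} (h j) /\<^sub>R (2 * pi * real p))
        {(0 - - (real j * pi)) /\<^sub>R (2 * pi * real p)..(pi - - (real j * pi)) /\<^sub>R (2 * pi * real p)}"
      by (rule has_integral_affinity'[of "h j" _ 0 pi _ "- (real j * pi)",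
            unfolded box_real DIM_real power_one_right])
    have *: "((\<lambda>t. (2 * pi * S) *\<^sub>R h j (2 * pi * real p * t + - (real j * pi))) has_integral
        (S / real p) *\<^sub>R integral {0..pi} (h j)) {real j / real (2 * p)..real (Suc j) / real (2 * p)}"
    proof -
      have "(0 - - (real j * pi)) /\<^sub>R (2 * pi * real p) = real j / real (2 * p)"
        and "(pi - - (real j * pi)) /\<^sub>R (2 * pi * real p) = real (Suc j) / real (2 * p)"
        and "2 * pi * S * inverse (2 * pi * real p) = S / real p"
        using p by (simp_all add: divide_simps) (simp_all add: algebra_simps)
      then show ?thesis
        using has_integral_cmul[OF aff, of "2 * pi * S"] by (simp only: scaleR_scaleR real_scaleR_def)
    qed
    show ?thesis
    \<comment> \<open>The integrands are compared only inside the piece; its two ends, where the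
      curve may jump, form a finite set and do not affect the integral.\<close>
    proof (rule has_integral_spike_finite[OF _ _ *])
      show "finite {real j / real (2 * p), real (Suc j) / real (2 * p)}"
        by simp
      fix t assume "t \<in> {real j / real (2 * p)..real (Suc j) / real (2 * p)}
                       - {real j / real (2 * p), real (Suc j) / real (2 * p)}"
      then have "real j / real (2 * p) < t" "t < real (Suc j) / real (2 * p)"
        by auto
      then have "real j < 2 * real p * t" "2 * real p * t < real (Suc j)"
        using p by (auto simp: field_simps)
      then have "pi * real j < pi * (2 * real p * t)" "pi * (2 * real p * t) < pi * real (Suc j)"
        by simp_all
      then have t: "real j * pi < 2 * pi * real p * t" "2 * pi * real p * t < real (Suc j) * pi"
        by (simp_all only: mult_ac)
      have "real q * (2 * pi * real p * t - real j * pi + real j * pi) / real p = 2 * pi * real q * t"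
        using p by simp
      then show "?G t = (2 * pi * S) *\<^sub>R h j (2 * pi * real p * t + - (real j * pi))"
        using weighted_speed_segment[OF p t, of q] sph_curve_segment[OF t, of q]
        by (simp add: h_def S_def)
    qed
  qed
  then have "(?G has_integral (\<Sum>j<2 * p. (S / real p) *\<^sub>R integral {0..pi} (h j))) {0..1}"
    using p by (intro has_integral_unit_interval_pieces) auto
  then show ?thesis
    unfolding weighted_curve_integral_def arc_integral_def h_def [abs_def] S_def
    by (simp add: integral_unique scaleR_sum_right)
qed

text \<open>Each of the 2p segments contributes the integral of \<open>sin\<close> over [0, \<pi>],
  which is 2.\<close>

lemma curve_mass_eq:
  assumes "p > 0"
  shows "curve_mass p q = 4 * sqrt ((real p)\<^sup>2 + (real q)\<^sup>2)"
proof -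
  have "(sin has_integral (- cos pi - - cos 0)) {0..pi}"
    by (rule fundamental_theorem_of_calculus)
       (auto intro!: derivative_eq_intros simp: has_real_derivative_iff_has_vector_derivative [symmetric])
  then have sin: "(sin has_integral (2 :: real)) {0..pi}"
    by simp
  then show ?thesis
    unfolding curve_mass_def using assms
    by (subst weighted_curve_integral_eq_sum) (auto simp: integral_unique has_integral_integrable)
qed

section \<open>Continuity of the harmonics, and cancellation of exponentials\<close>

lemma continuous_on_assoc_legendre_cos [continuous_intros]:
  "continuous_on A (\<lambda>\<theta>. assoc_legendre l k (cos \<theta>))"
  by (cases "k \<ge> 0") (auto simp: assoc_legendre_def Let_def intro!: continuous_intros)

lemma continuous_on_sph_harm_coord [continuous_intros]:
  assumes "continuous_on A a" "continuous_on A b"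
  shows "continuous_on A (\<lambda>x. sph_harm_coord l k (a x) (b x))"
proof -
  have "continuous_on A (\<lambda>x. assoc_legendre l k (cos (a x)))"
    using continuous_on_compose2[OF continuous_on_assoc_legendre_cos[of UNIV] assms(1)] by simp
  then show ?thesis
    unfolding sph_harm_coord_def using assms(2) by (intro continuous_intros)
qed

lemma integral_exp_int:
  fixes k :: int
  assumes "k \<noteq> 0"
  shows "((\<lambda>\<phi>. exp (\<i> * of_int k * of_real \<phi>)) has_integral 0) {0..2 * pi}"
proof -
  let ?F = "\<lambda>\<phi>. exp (\<i> * of_int k * of_real \<phi>) / (\<i> * of_int k)"
  have "((\<lambda>\<phi>. exp (\<i> * of_int k * of_real \<phi>)) has_integral (?F (2 * pi) - ?F 0)) {0..2 * pi}"
    using assms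
    by (intro fundamental_theorem_of_calculus)
       (auto intro!: derivative_eq_intros has_vector_derivative_real_field simp: field_simps)
  moreover have "exp (\<i> * of_int k * of_real (2 * pi)) = 1"
    by (subst exp_eq_1) auto
  ultimately show ?thesis
    by simp
qed

text \<open>The ratio of the geometric sum is a \<open>2p\<close>-th root of unity, and equals 1 only if
  \<open>2p\<close> divides \<open>kq\<close>.\<close>

lemma sum_exp_shifts:
  fixes k :: int
  assumes "p > 0" "coprime (2 * p) q" "\<bar>k\<bar> < int (2 * p)"
  shows "(\<Sum>j<2 * p. exp (\<i> * of_int k * of_real (real q * (s + real j * pi) / real p)))
    = (if k = 0 then of_nat (2 * p) else 0)"
proof (cases "k = 0")
  case False
  define w where "w = exp (\<i> * of_real (of_int k * real q * pi / real p))"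
  have "exp (\<i> * of_int k * of_real (real q * (s + real j * pi) / real p))
      = exp (\<i> * of_int k * of_real (real q * s / real p)) * w ^ j" for j
    using assms(1) unfolding w_def exp_of_nat_mult [symmetric] exp_add [symmetric]
    by (intro arg_cong[where f = exp]) (simp add: field_simps)
  then have eq: "(\<Sum>j<2 * p. exp (\<i> * of_int k * of_real (real q * (s + real j * pi) / real p)))
      = exp (\<i> * of_int k * of_real (real q * s / real p)) * (\<Sum>j<2 * p. w ^ j)"
    by (simp add: sum_distrib_left)
  have "w \<noteq> 1"
  proof
    assume "w = 1"
    then obtain m :: int where "of_int k * real q * pi / real p = of_int (2 * m) * pi"
      unfolding w_def by (auto simp: exp_eq_1)
    then have "(of_int k * real q) * pi = (of_int (2 * m) * real p) * pi"
      using assms(1) by (simp add: field_simps)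
    then have "of_int k * real q = of_int (2 * m) * real p"
      by simp
    then have "real_of_int (k * int q) = real_of_int (int (2 * p) * m)"
      by simp
    then have "k * int q = int (2 * p) * m"
      by (simp only: of_int_eq_iff)
    then have "int (2 * p) dvd k * int q"
      by simp
    \<comment> \<open>Coprimality moves the divisibility to \<open>k\<close>, which is impossible
      for 0 < |k| < 2p.\<close>
    moreover have "coprime (int (2 * p)) (int q)"
      using assms(2) by (simp only: coprime_int_iff)
    ultimately have "int (2 * p) dvd k"
      by (simp only: coprime_dvd_mult_left_iff)
    then show False
      using False assms(3) dvd_imp_le_int[of k "int (2 * p)"] by simp
  qed
  \<comment> \<open>The exponent of this power is 2 \<pi> i k q, which explains the witness
    \<open>k * int q\<close>.\<close>
  moreover have "w ^ (2 * p) = 1"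
    unfolding w_def exp_of_nat_mult [symmetric] using assms(1)
    by (subst exp_eq_1) (auto intro!: exI[of _ "k * int q"])
  ultimately have "(\<Sum>j<2 * p. w ^ j) = 0"
    by (simp add: sum_gp_strict)
  then show ?thesis
    using eq False by simp
qed simp

section \<open>Both integrals of a spherical polynomial\<close>

context
  fixes n :: nat and c :: "nat \<Rightarrow> int \<Rightarrow> complex" and f :: "real ^ 3 \<Rightarrow> complex"
  assumes f: "\<And>x. x \<in> sphere 0 1 \<Longrightarrow>
      f x = (\<Sum>l = 0..n. \<Sum>k = - int l..int l. c l k * sph_harm l k x)"
begin

text \<open>The range of \<open>s\<close> lets \<open>sph_harm\<close> recover the colatitude by
  \<open>arccos\<close>.\<close>

lemma poly_sph_point:
  assumes "s \<in> {0..pi}"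
  shows "f (sph_point s \<phi>) = (\<Sum>l = 0..n. \<Sum>k = - int l..int l. c l k * sph_harm_coord l k s \<phi>)"
  using assms by (simp add: f[OF sph_point_in_sphere] sph_harm_sph_point)

text \<open>For s in [0, \<pi>] this is the mean of \<open>f\<close> over the circle of colatitude
  s.\<close>

definition zonal :: "real \<Rightarrow> complex" where
  "zonal s = (\<Sum>l = 0..n. c l 0 * of_real (assoc_legendre l 0 (cos s)))"

lemma sphere_integral_poly:
  "sphere_integral f = (2 * pi) *\<^sub>R integral {0..pi} (\<lambda>s. sin s *\<^sub>R zonal s)"
proof -
  define A where "A l k = integral {0..pi} (\<lambda>s. sin s *\<^sub>R (of_real (assoc_legendre l k (cos s)) :: complex))"
    for l k
  have A: "((\<lambda>s. sin s *\<^sub>R (of_real (assoc_legendre l k (cos s)) :: complex)) has_integral A l k) {0..pi}" for l k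
    unfolding A_def
    by (intro integrable_integral integrable_continuous_interval continuous_intros)
  \<comment> \<open>The variables separate: integrating out the colatitude leaves a trigonometric
    polynomial in the longitude.\<close>
  have inner: "integral {0..pi} (\<lambda>s. sin s *\<^sub>R f (sph_point s \<phi>))
      = (\<Sum>l = 0..n. \<Sum>k = - int l..int l. c l k * A l k * exp (\<i> * of_int k * of_real \<phi>))" for \<phi>
  proof (rule integral_unique)
    have "((\<lambda>s. \<Sum>l = 0..n. \<Sum>k = - int l..int l.
              (c l k * exp (\<i> * of_int k * of_real \<phi>)) * (sin s *\<^sub>R of_real (assoc_legendre l k (cos s))))
        has_integral (\<Sum>l = 0..n. \<Sum>k = - int l..int l. (c l k * exp (\<i> * of_int k * of_real \<phi>)) * A l k)) {0..pi}"
      by (intro has_integral_sum has_integral_mult_right A) auto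
    then show "((\<lambda>s. sin s *\<^sub>R f (sph_point s \<phi>)) has_integral
        (\<Sum>l = 0..n. \<Sum>k = - int l..int l. c l k * A l k * exp (\<i> * of_int k * of_real \<phi>))) {0..pi}"
      by (rule has_integral_eq_rhs[OF has_integral_eq, rotated])
         (auto simp: poly_sph_point sph_harm_coord_def scaleR_conv_of_real sum_distrib_left mult_ac)
  qed
  have "((\<lambda>\<phi>. exp (\<i> * of_int k * of_real \<phi>)) has_integral (if k = 0 then of_real (2 * pi) else 0)) {0..2 * pi}"
    for k :: int
    using integral_exp_int[of k] has_integral_const_real[of "1 :: complex" 0 "2 * pi"]
    by (auto simp: scaleR_conv_of_real)
  then have "((\<lambda>\<phi>. \<Sum>l = 0..n. \<Sum>k = - int l..int l. c l k * A l k * exp (\<i> * of_int k * of_real \<phi>))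
      has_integral (\<Sum>l = 0..n. \<Sum>k = - int l..int l. c l k * A l k * (if k = 0 then of_real (2 * pi) else 0))) {0..2 * pi}"
    by (intro has_integral_sum has_integral_mult_right) auto
  then have "sphere_integral f
      = (\<Sum>l = 0..n. \<Sum>k = - int l..int l. c l k * A l k * (if k = 0 then of_real (2 * pi) else 0))"
    unfolding sphere_integral_def inner by (rule integral_unique)
  also have "\<dots> = (2 * pi) *\<^sub>R (\<Sum>l = 0..n. c l 0 * A l 0)"
    by (simp add: if_distrib[where f = "(*) _"] sum.delta scaleR_conv_of_real sum_distrib_left mult_ac
        cong: if_cong)
  also have "(\<Sum>l = 0..n. c l 0 * A l 0) = integral {0..pi} (\<lambda>s. sin s *\<^sub>R zonal s)"
  proof (rule integral_unique[symmetric])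
    have "((\<lambda>s. \<Sum>l = 0..n. c l 0 * (sin s *\<^sub>R of_real (assoc_legendre l 0 (cos s))))
        has_integral (\<Sum>l = 0..n. c l 0 * A l 0)) {0..pi}"
      by (intro has_integral_sum has_integral_mult_right A) auto
    then show "((\<lambda>s. sin s *\<^sub>R zonal s) has_integral (\<Sum>l = 0..n. c l 0 * A l 0)) {0..pi}"
      by (simp add: zonal_def scaleR_sum_right)
  qed
  finally show ?thesis .
qed

lemma weighted_curve_integral_poly:
  assumes p: "p > 0" and "coprime (2 * p) q" and "n < 2 * p"
  shows "weighted_curve_integral p q f
    = (2 * sqrt ((real p)\<^sup>2 + (real q)\<^sup>2)) *\<^sub>R integral {0..pi} (\<lambda>s. sin s *\<^sub>R zonal s)"
proof -
  define \<Phi> where "\<Phi> j s = real q * (s + real j * pi) / real p" for j s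
  have cont: "continuous_on {0..pi} (\<Phi> j)" for j
    unfolding \<Phi>_def using p by (intro continuous_intros) auto
  have int: "(\<lambda>s. sin s *\<^sub>R f (sph_point s (\<Phi> j s))) integrable_on {0..pi}" for j
  proof -
    have "(\<lambda>s. sin s *\<^sub>R (\<Sum>l = 0..n. \<Sum>k = - int l..int l. c l k * sph_harm_coord l k s (\<Phi> j s)))
        integrable_on {0..pi}"
      by (intro integrable_continuous_interval continuous_intros cont)
    then show ?thesis
      by (rule integrable_eq) (simp add: poly_sph_point)
  qed
  \<comment> \<open>Moving the sum over \<open>j\<close> innermost isolates the exponentials. Since
    |k| \<le> l \<le> n < 2p, \<open>sum_exp_shifts\<close> applies to every term.\<close>
  have sum: "(\<Sum>j<2 * p. f (sph_point s (\<Phi> j s))) = of_nat (2 * p) * zonal s" if "s \<in> {0..pi}" for s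
  proof -
    have "(\<Sum>j<2 * p. f (sph_point s (\<Phi> j s))) = (\<Sum>j<2 * p. \<Sum>l = 0..n. \<Sum>k = - int l..int l.
        c l k * of_real (assoc_legendre l k (cos s)) * exp (\<i> * of_int k * of_real (\<Phi> j s)))"
      using that by (simp add: poly_sph_point sph_harm_coord_def mult_ac)
    also have "\<dots> = (\<Sum>l = 0..n. \<Sum>j<2 * p. \<Sum>k = - int l..int l.
        c l k * of_real (assoc_legendre l k (cos s)) * exp (\<i> * of_int k * of_real (\<Phi> j s)))"
      by (rule sum.swap)
    also have "\<dots> = (\<Sum>l = 0..n. \<Sum>k = - int l..int l.
        c l k * of_real (assoc_legendre l k (cos s)) * (\<Sum>j<2 * p. exp (\<i> * of_int k * of_real (\<Phi> j s))))"
      unfolding sum_distrib_left by (intro sum.cong refl sum.swap)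
    also have "\<dots> = (\<Sum>l = 0..n. \<Sum>k = - int l..int l.
        c l k * of_real (assoc_legendre l k (cos s)) * (if k = 0 then of_nat (2 * p) else 0))"
      unfolding \<Phi>_def using assms
      by (intro sum.cong refl arg_cong2[where f = "(*)"] sum_exp_shifts) auto
    also have "\<dots> = of_nat (2 * p) * zonal s"
      by (simp add: if_distrib[where f = "(*) _"] sum.delta zonal_def sum_distrib_left mult_ac cong: if_cong)
    finally show ?thesis .
  qed
  have "weighted_curve_integral p q f = (sqrt ((real p)\<^sup>2 + (real q)\<^sup>2) / real p) *\<^sub>R
      (\<Sum>j<2 * p. integral {0..pi} (\<lambda>s. sin s *\<^sub>R f (sph_point s (\<Phi> j s))))"
    unfolding \<Phi>_def by (rule weighted_curve_integral_eq_sum[OF p]) (use int in \<open>simp add: \<Phi>_def\<close>)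
  \<comment> \<open>Exchanging sum and integral lets the segments be averaged pointwise, at a common
    colatitude.\<close>
  also have "(\<Sum>j<2 * p. integral {0..pi} (\<lambda>s. sin s *\<^sub>R f (sph_point s (\<Phi> j s))))
      = integral {0..pi} (\<lambda>s. \<Sum>j<2 * p. sin s *\<^sub>R f (sph_point s (\<Phi> j s)))"
    using int by (intro integral_sum [symmetric]) auto
  also have "\<dots> = integral {0..pi} (\<lambda>s. real (2 * p) *\<^sub>R (sin s *\<^sub>R zonal s))"
    by (rule integral_cong) (simp add: sum sum_distrib_left [symmetric] scaleR_conv_of_real)
  also have "\<dots> = real (2 * p) *\<^sub>R integral {0..pi} (\<lambda>s. sin s *\<^sub>R zonal s)"
    by (rule integral_cmul)
  finally show ?thesis
    using p by simp
qed

end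

theorem theorem4p6:
  fixes n p q :: nat
    and c :: "nat \<Rightarrow> int \<Rightarrow> complex"
    and f :: "real ^ 3 \<Rightarrow> complex"
  assumes f: "\<And>x. x \<in> sphere 0 1 \<Longrightarrow>
      f x = (\<Sum>l = 0..n. \<Sum>k = - int l..int l. c l k * sph_harm l k x)"
    and "p \<ge> 1" and "q \<ge> 1"
    and "coprime (2 * p) q"
    and "p > n"
  shows "(1 / (4 * pi)) *\<^sub>R sphere_integral f
           = (1 / curve_mass p q) *\<^sub>R weighted_curve_integral p q f
         \<and> curve_mass p q = 4 * sqrt ((real p)\<^sup>2 + (real q)\<^sup>2)"
proof -
  \<comment> \<open>Writing S for this root, S > 0 allows division by the mass 4 S; then 2 \<pi> /
    (4 \<pi>) and 2 S / (4 S) both equal 1/2, the common factor of the zonal integral.\<close>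
  have "sqrt ((real p)\<^sup>2 + (real q)\<^sup>2) > 0"
    using \<open>p \<ge> 1\<close> by (simp add: add_pos_nonneg)
  then show ?thesis
    using assms curve_mass_eq[of p q] sphere_integral_poly[OF f] weighted_curve_integral_poly[OF f, of p q]
    by simp
qed

end
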